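(* The category $\mathcal{ST}$ of skew trusses (with skew truss homomorphisms) and the category $\mathcal{WTG}$ of weak twisted post-groups (with weak twisted post-group homomorphisms) are isomorphic.
   Context: A weak twisted post-group $(G,\cdot,\rhd,\Phi)$ is a group $(G,\cdot)$ with maps $\rhd:G\times G\to G$ and $\Phi:G\to G$ such that, setting $a\circ b=\Phi(a)\cdot(a\rhd b)$, for all $a,b,c\in G$: (1) $b\mapsto a\rhd b$ is a group endomorphism of $(G,\cdot)$; (2) $(a\circ b)\rhd c=a\rhd(b\rhd c)$; (3) $\Phi(a\circ b)=a\circ\Phi(b)$. A homomorphism of weak twisted post-groups is a map $F$ preserving $\cdot$ and $\rhd$ and satisfying $F\Phi_G=\Phi_H F$. A skew (left) truss is a quadruple $(G,\cdot,\circ,\Phi)$ where $(G,\cdot)$ is a group, $(G,\circ)$ is a semigroup, and $\Phi:G\to G$ is a map such that $a\circ(b\cdot c)=(a\circ b)\cdot\Phi(a)^{-1}\cdot(a\circ c)$ for all $a,b,c\in G$ (inverse in $(G,\cdot)$). A skew truss homomorphism $(G,\cdot_G,\circ_G,\Phi_G)\to(H,\cdot_H,\circ_H,\Phi_H)$ is a map $F:G\to H$ that is a group homomorphism $(G,\cdot_G)\to(H,\cdot_H)$ and a semigroup homomorphism $(G,\circ_G)\to(H,\circ_H)$. *)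

theory Defs
  imports "HOL-Algebra.Group"
begin

text \<open>A group together with a self-map \<open>\<Phi>\<close> of its carrier, extended by the second operation
  \<open>\<circ>\<close>, written \<open>\<odot>\<close>, for skew trusses and by \<open>\<rhd>\<close> for weak twisted post-groups. The derived operation
  \<open>a \<circ> b = \<Phi>(a) \<cdot> (a \<rhd> b)\<close> of the latter is written \<open>\<bullet>\<close>.\<close>

record 'a twisted_monoid = "'a monoid" +
  Phi :: "'a \<Rightarrow> 'a" (\<open>\<Phi>\<index>\<close>)

record 'a skew_truss = "'a twisted_monoid" +
  circ :: "'a \<Rightarrow> 'a \<Rightarrow> 'a" (infixl \<open>\<odot>\<index>\<close> 70)

record 'a weak_twisted_post_group = "'a twisted_monoid" +
  rhd :: "'a \<Rightarrow> 'a \<Rightarrow> 'a" (infixr \<open>\<rhd>\<index>\<close> 75)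

locale skew_truss = group G for G :: "('a, 'b) skew_truss_scheme" (structure) +
  assumes Phi_closed: "a \<in> carrier G \<Longrightarrow> \<Phi> a \<in> carrier G"
    and circ_closed: "\<lbrakk>a \<in> carrier G; b \<in> carrier G\<rbrakk> \<Longrightarrow> a \<odot> b \<in> carrier G"
    and circ_assoc:
      "\<lbrakk>a \<in> carrier G; b \<in> carrier G; c \<in> carrier G\<rbrakk> \<Longrightarrow> (a \<odot> b) \<odot> c = a \<odot> (b \<odot> c)"
    and circ_mult:
      "\<lbrakk>a \<in> carrier G; b \<in> carrier G; c \<in> carrier G\<rbrakk> \<Longrightarrow>
        a \<odot> (b \<otimes> c) = (a \<odot> b) \<otimes> inv (\<Phi> a) \<otimes> (a \<odot> c)"

definition post_circ ::
  "('a, 'b) weak_twisted_post_group_scheme \<Rightarrow> 'a \<Rightarrow> 'a \<Rightarrow> 'a" (infixl \<open>\<bullet>\<index>\<close> 70)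
  where "a \<bullet>\<^bsub>G\<^esub> b = \<Phi>\<^bsub>G\<^esub> a \<otimes>\<^bsub>G\<^esub> (a \<rhd>\<^bsub>G\<^esub> b)"

locale weak_twisted_post_group = group G
  for G :: "('a, 'b) weak_twisted_post_group_scheme" (structure) +
  assumes Phi_closed: "a \<in> carrier G \<Longrightarrow> \<Phi> a \<in> carrier G"
    and rhd_hom: "a \<in> carrier G \<Longrightarrow> (\<lambda>b. a \<rhd> b) \<in> hom G G"
    and post_circ_rhd:
      "\<lbrakk>a \<in> carrier G; b \<in> carrier G; c \<in> carrier G\<rbrakk> \<Longrightarrow> (a \<bullet> b) \<rhd> c = a \<rhd> (b \<rhd> c)"
    and Phi_post_circ:
      "\<lbrakk>a \<in> carrier G; b \<in> carrier G\<rbrakk> \<Longrightarrow> \<Phi> (a \<bullet> b) = a \<bullet> \<Phi> b"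

text \<open>Homomorphisms are represented by their extensional representatives, so that two of them are
  equal iff they agree on the carrier of the domain.\<close>

definition skew_truss_hom ::
  "('a, 'b) skew_truss_scheme \<Rightarrow> ('c, 'd) skew_truss_scheme \<Rightarrow> ('a \<Rightarrow> 'c) set"
  where "skew_truss_hom G H = {F \<in> hom G H \<inter> extensional (carrier G).
    \<forall>a \<in> carrier G. \<forall>b \<in> carrier G. F (a \<odot>\<^bsub>G\<^esub> b) = F a \<odot>\<^bsub>H\<^esub> F b}"

definition weak_twisted_post_group_hom ::
  "('a, 'b) weak_twisted_post_group_scheme \<Rightarrow> ('c, 'd) weak_twisted_post_group_scheme \<Rightarrow>
    ('a \<Rightarrow> 'c) set"
  where "weak_twisted_post_group_hom G H = {F \<in> hom G H \<inter> extensional (carrier G).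
    (\<forall>a \<in> carrier G. \<forall>b \<in> carrier G. F (a \<rhd>\<^bsub>G\<^esub> b) = F a \<rhd>\<^bsub>H\<^esub> F b) \<and>
    (\<forall>a \<in> carrier G. F (\<Phi>\<^bsub>G\<^esub> a) = \<Phi>\<^bsub>H\<^esub> (F a))}"

text \<open>Categories are given by a set of objects and a family of hom-sets. The hom-sets need not be
  disjoint: \<open>Comp C X Y Z g f\<close> is the composite of \<open>f \<in> Hom C X Y\<close> and \<open>g \<in> Hom C Y Z\<close>, and the
  action of a functor on morphisms is likewise indexed by domain and codomain.\<close>

record ('o, 'm) category =
  Obj :: "'o set"
  Hom :: "'o \<Rightarrow> 'o \<Rightarrow> 'm set"
  Comp :: "'o \<Rightarrow> 'o \<Rightarrow> 'o \<Rightarrow> 'm \<Rightarrow> 'm \<Rightarrow> 'm"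
  Ident :: "'o \<Rightarrow> 'm"

locale category =
  fixes C :: "('o, 'm) category"
  assumes Ident_closed: "X \<in> Obj C \<Longrightarrow> Ident C X \<in> Hom C X X"
    and Comp_closed:
      "\<lbrakk>X \<in> Obj C; Y \<in> Obj C; Z \<in> Obj C; f \<in> Hom C X Y; g \<in> Hom C Y Z\<rbrakk> \<Longrightarrow>
        Comp C X Y Z g f \<in> Hom C X Z"
    and Comp_Ident_right:
      "\<lbrakk>X \<in> Obj C; Y \<in> Obj C; f \<in> Hom C X Y\<rbrakk> \<Longrightarrow> Comp C X X Y f (Ident C X) = f"
    and Comp_Ident_left:
      "\<lbrakk>X \<in> Obj C; Y \<in> Obj C; f \<in> Hom C X Y\<rbrakk> \<Longrightarrow> Comp C X Y Y (Ident C Y) f = f"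
    and Comp_assoc:
      "\<lbrakk>W \<in> Obj C; X \<in> Obj C; Y \<in> Obj C; Z \<in> Obj C;
        f \<in> Hom C W X; g \<in> Hom C X Y; h \<in> Hom C Y Z\<rbrakk> \<Longrightarrow>
        Comp C W Y Z h (Comp C W X Y g f) = Comp C W X Z (Comp C X Y Z h g) f"

record ('o1, 'm1, 'o2, 'm2) cat_functor =
  on_obj :: "'o1 \<Rightarrow> 'o2"
  on_mor :: "'o1 \<Rightarrow> 'o1 \<Rightarrow> 'm1 \<Rightarrow> 'm2"

locale cat_functor = source: category C + target: category D
  for C :: "('o1, 'm1) category" and D :: "('o2, 'm2) category" +
  fixes F :: "('o1, 'm1, 'o2, 'm2) cat_functor"
  assumes on_obj_closed: "X \<in> Obj C \<Longrightarrow> on_obj F X \<in> Obj D"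
    and on_mor_closed:
      "\<lbrakk>X \<in> Obj C; Y \<in> Obj C; f \<in> Hom C X Y\<rbrakk> \<Longrightarrow>
        on_mor F X Y f \<in> Hom D (on_obj F X) (on_obj F Y)"
    and on_mor_Ident: "X \<in> Obj C \<Longrightarrow> on_mor F X X (Ident C X) = Ident D (on_obj F X)"
    and on_mor_Comp:
      "\<lbrakk>X \<in> Obj C; Y \<in> Obj C; Z \<in> Obj C; f \<in> Hom C X Y; g \<in> Hom C Y Z\<rbrakk> \<Longrightarrow>
        on_mor F X Z (Comp C X Y Z g f) =
          Comp D (on_obj F X) (on_obj F Y) (on_obj F Z) (on_mor F Y Z g) (on_mor F X Y f)"

definition cat_functor_comp ::
  "('o2, 'm2, 'o3, 'm3) cat_functor \<Rightarrow> ('o1, 'm1, 'o2, 'm2) cat_functor \<Rightarrow>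
    ('o1, 'm1, 'o3, 'm3) cat_functor"
  where "cat_functor_comp K F =
    \<lparr>on_obj = (\<lambda>X. on_obj K (on_obj F X)),
     on_mor = (\<lambda>X Y f. on_mor K (on_obj F X) (on_obj F Y) (on_mor F X Y f))\<rparr>"

definition is_identity_functor ::
  "('o, 'm) category \<Rightarrow> ('o, 'm, 'o, 'm) cat_functor \<Rightarrow> bool"
  where "is_identity_functor C F \<longleftrightarrow>
    (\<forall>X \<in> Obj C. on_obj F X = X) \<and>
    (\<forall>X \<in> Obj C. \<forall>Y \<in> Obj C. \<forall>f \<in> Hom C X Y. on_mor F X Y f = f)"

definition isomorphic_categories ::
  "('o1, 'm1) category \<Rightarrow> ('o2, 'm2) category \<Rightarrow> bool"
  where "isomorphic_categories C D \<longleftrightarrow> category C \<and> category D \<and>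
    (\<exists>F K. cat_functor C D F \<and> cat_functor D C K \<and>
      is_identity_functor C (cat_functor_comp K F) \<and>
      is_identity_functor D (cat_functor_comp F K))"

text \<open>The two categories have as objects all structures whose carrier is a subset of the type
  \<open>'a\<close>. HOL operations are total functions, so the objects are normalised to be undefined outside
  the carrier; otherwise one and the same structure would be represented by many records. The
  component \<open>one\<close> needs no normalisation, being determined by the group axioms.\<close>

definition ST :: "('a skew_truss, 'a \<Rightarrow> 'a) category"
  where "ST =
    \<lparr>Obj = {G. skew_truss G \<and>
        case_prod (mult G) \<in> extensional (carrier G \<times> carrier G) \<and>
        Phi G \<in> extensional (carrier G) \<and>
        case_prod (circ G) \<in> extensional (carrier G \<times> carrier G)},
     Hom = skew_truss_hom,
     Comp = (\<lambda>X Y Z g f. compose (carrier X) g f),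
     Ident = (\<lambda>X. \<lambda>x \<in> carrier X. x)\<rparr>"

definition WTG :: "('a weak_twisted_post_group, 'a \<Rightarrow> 'a) category"
  where "WTG =
    \<lparr>Obj = {G. weak_twisted_post_group G \<and>
        case_prod (mult G) \<in> extensional (carrier G \<times> carrier G) \<and>
        Phi G \<in> extensional (carrier G) \<and>
        case_prod (rhd G) \<in> extensional (carrier G \<times> carrier G)},
     Hom = weak_twisted_post_group_hom,
     Comp = (\<lambda>X Y Z g f. compose (carrier X) g f),
     Ident = (\<lambda>X. \<lambda>x \<in> carrier X. x)\<rparr>"

end

theory Submission
  imports Defs
begin

text \<open>The two kinds of structure are the same data in different coordinates. On a fixed group with
  a fixed map \<open>\<Phi>\<close>, the equation \<open>a \<circ> b = \<Phi>(a) \<cdot> (a \<rhd> b)\<close> can be solved for either operation, the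
  inverse transformation being \<open>a \<rhd> b = \<Phi>(a)\<^sup>-\<^sup>1 \<cdot> (a \<circ> b)\<close>, and under it the axioms correspond:
  the truss law \<open>a \<circ> (b \<cdot> c) = (a \<circ> b) \<cdot> \<Phi>(a)\<^sup>-\<^sup>1 \<cdot> (a \<circ> c)\<close> says, after multiplication by \<open>\<Phi>(a)\<^sup>-\<^sup>1\<close>,
  that \<open>a \<rhd> -\<close> is an endomorphism, and, given this, associativity of \<open>\<circ>\<close> corresponds to the two
  remaining axioms together (\<open>truss_rhd_circ\<close>, \<open>Phi_circ\<close> and, conversely, \<open>post_circ_assoc\<close>).

  The one thing that is not formal is the role of \<open>\<Phi>\<close>, which a skew truss homomorphism is not
  required to preserve. The truss law at \<open>b = c = 1\<close> forces \<open>\<Phi>(a) = a \<circ> 1\<close>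
  (lemma \<open>circ_one\<close>), so \<open>\<Phi>\<close> is determined by the two operations. It follows that homomorphisms
  preserve it, and that \<open>\<Phi>(a \<circ> b) = a \<circ> \<Phi>(b)\<close> is associativity with third argument \<open>1\<close>.

  Hence the transformation is a bijection of objects under which the sets of homomorphisms are
  literally equal (\<open>hom_wtg_of_truss\<close>), and the functors act on morphisms as the identity.\<close>

section \<open>Categories of structured sets and their isomorphisms\<close>

lemma category_of_extensional_functions:
  assumes Hom: "\<And>X Y. \<lbrakk>X \<in> Obj C; Y \<in> Obj C\<rbrakk> \<Longrightarrow>
      Hom C X Y \<subseteq> (carrier X \<rightarrow> carrier Y) \<inter> extensional (carrier X)"
    and Comp: "\<And>X Y Z g f. Comp C X Y Z g f = compose (carrier X) g f"
    and Ident: "\<And>X. Ident C X = (\<lambda>x \<in> carrier X. x)"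
    and Ident_closed: "\<And>X. X \<in> Obj C \<Longrightarrow> (\<lambda>x \<in> carrier X. x) \<in> Hom C X X"
    and compose_closed: "\<And>X Y Z f g.
      \<lbrakk>X \<in> Obj C; Y \<in> Obj C; Z \<in> Obj C; f \<in> Hom C X Y; g \<in> Hom C Y Z\<rbrakk> \<Longrightarrow>
        compose (carrier X) g f \<in> Hom C X Z"
  shows "category C"
proof
  fix X Y f assume *: "X \<in> Obj C" "Y \<in> Obj C" "f \<in> Hom C X Y"
  have f: "f \<in> carrier X \<rightarrow> carrier Y" "f \<in> extensional (carrier X)"
    using Hom[OF *(1,2)] *(3) by blast+
  show "Comp C X X Y f (Ident C X) = f"
    using compose_Id[OF f] by (simp add: Comp Ident)
  show "Comp C X Y Y (Ident C Y) f = f"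
    using Id_compose[OF f] by (simp add: Comp Ident)
next
  fix W X Y Z f g h
  assume *: "W \<in> Obj C" "X \<in> Obj C" "Y \<in> Obj C" "Z \<in> Obj C"
    "f \<in> Hom C W X" "g \<in> Hom C X Y" "h \<in> Hom C Y Z"
  have "f \<in> carrier W \<rightarrow> carrier X"
    using Hom[OF *(1,2)] *(5) by blast
  then show "Comp C W Y Z h (Comp C W X Y g f) = Comp C W X Z (Comp C X Y Z h g) f"
    unfolding Comp by (rule compose_assoc)
qed (simp_all add: Comp Ident Ident_closed compose_closed)

text \<open>A functor that leaves morphisms unchanged is invertible as soon as it is bijective on objects
  and its hom-sets on both sides agree.\<close>

lemma isomorphic_categories_by_objects:
  assumes C: "category C" and D: "category D"
    and P: "\<And>X. X \<in> Obj C \<Longrightarrow> P X \<in> Obj D" and Q: "\<And>Y. Y \<in> Obj D \<Longrightarrow> Q Y \<in> Obj C"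
    and QP: "\<And>X. X \<in> Obj C \<Longrightarrow> Q (P X) = X" and PQ: "\<And>Y. Y \<in> Obj D \<Longrightarrow> P (Q Y) = Y"
    and Hom: "\<And>X Y. \<lbrakk>X \<in> Obj C; Y \<in> Obj C\<rbrakk> \<Longrightarrow> Hom D (P X) (P Y) = Hom C X Y"
    and Comp: "\<And>X Y Z g f. \<lbrakk>X \<in> Obj C; Y \<in> Obj C; Z \<in> Obj C\<rbrakk> \<Longrightarrow>
      Comp D (P X) (P Y) (P Z) g f = Comp C X Y Z g f"
    and Ident: "\<And>X. X \<in> Obj C \<Longrightarrow> Ident D (P X) = Ident C X"
  shows "isomorphic_categories C D"
proof -
  let ?F = "\<lparr>on_obj = P, on_mor = (\<lambda>X Y f. f)\<rparr>" and ?K = "\<lparr>on_obj = Q, on_mor = (\<lambda>X Y f. f)\<rparr>"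
  \<comment> \<open>Every object of \<open>D\<close> is \<open>P (Q Y)\<close>, so the assumptions also describe \<open>D\<close> through \<open>Q\<close>.\<close>
  have Hom': "Hom C (Q X) (Q Y) = Hom D X Y" if "X \<in> Obj D" "Y \<in> Obj D" for X Y
    using Hom[OF Q Q, OF that] that by (simp add: PQ)
  have Comp': "Comp C (Q X) (Q Y) (Q Z) g f = Comp D X Y Z g f"
    if "X \<in> Obj D" "Y \<in> Obj D" "Z \<in> Obj D" for X Y Z g f
    using Comp[OF Q Q Q, OF that] that by (simp add: PQ)
  have Ident': "Ident C (Q X) = Ident D X" if "X \<in> Obj D" for X
    using Ident[OF Q, OF that] that by (simp add: PQ)
  have "cat_functor C D ?F"
    by (intro cat_functor.intro cat_functor_axioms.intro C D) (simp_all add: P Hom Comp Ident)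
  moreover have "cat_functor D C ?K"
    by (intro cat_functor.intro cat_functor_axioms.intro C D) (simp_all add: Q Hom' Comp' Ident')
  moreover have "is_identity_functor C (cat_functor_comp ?K ?F)"
    "is_identity_functor D (cat_functor_comp ?F ?K)"
    by (simp_all add: is_identity_functor_def cat_functor_comp_def QP PQ)
  ultimately show ?thesis
    unfolding isomorphic_categories_def using C D by blast
qed

text \<open>Skew trusses and weak twisted post-groups are different record types over the same underlying
  group, so the group structure has to be carried from one record to the other.\<close>

lemma group_of_same_operations:
  assumes "group G" "carrier H = carrier G" "mult H = mult G" "one H = one G"
  shows "group H"
proof -
  interpret group G by fact
  show ?thesis
    by (rule groupI) (simp_all add: assms m_assoc l_inv_ex)
qed

section \<open>From skew trusses to weak twisted post-groups\<close>

definition truss_rhd :: "('a, 'b) skew_truss_scheme \<Rightarrow> 'a \<Rightarrow> 'a \<Rightarrow> 'a"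
  where "truss_rhd G a b = inv\<^bsub>G\<^esub> (\<Phi>\<^bsub>G\<^esub> a) \<otimes>\<^bsub>G\<^esub> (a \<odot>\<^bsub>G\<^esub> b)"

definition wtg_of_truss :: "('a, 'b) skew_truss_scheme \<Rightarrow> 'a weak_twisted_post_group"
  where "wtg_of_truss G =
    \<lparr>carrier = carrier G, mult = mult G, one = one G, Phi = Phi G,
     rhd = curry (restrict (case_prod (truss_rhd G)) (carrier G \<times> carrier G))\<rparr>"

lemma wtg_of_truss_simps [simp]:
  "carrier (wtg_of_truss G) = carrier G" "mult (wtg_of_truss G) = mult G"
  "one (wtg_of_truss G) = one G" "Phi (wtg_of_truss G) = Phi G"
  "\<lbrakk>a \<in> carrier G; b \<in> carrier G\<rbrakk> \<Longrightarrow> a \<rhd>\<^bsub>wtg_of_truss G\<^esub> b = truss_rhd G a b"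
  by (simp_all add: wtg_of_truss_def)

context skew_truss
begin

text \<open>At \<open>b = c = 1\<close> the truss law reads \<open>x = x \<cdot> \<Phi>(a)\<^sup>-\<^sup>1 \<cdot> x\<close> for \<open>x = a \<circ> 1\<close>; cancel \<open>x\<close>.\<close>

lemma circ_one:
  assumes a: "a \<in> carrier G"
  shows "a \<odot> \<one> = \<Phi> a"
proof -
  have x: "a \<odot> \<one> \<in> carrier G" and p: "\<Phi> a \<in> carrier G"
    using a by (simp_all add: circ_closed Phi_closed)
  have "(a \<odot> \<one>) \<otimes> (inv (\<Phi> a) \<otimes> (a \<odot> \<one>)) = (a \<odot> \<one>) \<otimes> \<one>"
    using circ_mult[of a \<one> \<one>] a x p by (simp add: m_assoc)
  then have "inv (\<Phi> a) \<otimes> (a \<odot> \<one>) = \<one>"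
    using x p by simp
  then show ?thesis
    using x p inv_solve_left' by fastforce
qed

lemma Phi_circ:
  assumes "a \<in> carrier G" "b \<in> carrier G"
  shows "\<Phi> (a \<odot> b) = a \<odot> \<Phi> b"
  using assms circ_assoc[of a b \<one>] by (simp add: circ_one circ_closed)

lemma truss_rhd_closed:
  "\<lbrakk>a \<in> carrier G; b \<in> carrier G\<rbrakk> \<Longrightarrow> truss_rhd G a b \<in> carrier G"
  by (simp add: truss_rhd_def circ_closed Phi_closed)

lemma Phi_mult_truss_rhd:
  "\<lbrakk>a \<in> carrier G; b \<in> carrier G\<rbrakk> \<Longrightarrow> \<Phi> a \<otimes> truss_rhd G a b = a \<odot> b"
  by (simp add: truss_rhd_def circ_closed Phi_closed flip: m_assoc)

lemma truss_rhd_mult: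
  assumes "a \<in> carrier G" "b \<in> carrier G" "c \<in> carrier G"
  shows "truss_rhd G a (b \<otimes> c) = truss_rhd G a b \<otimes> truss_rhd G a c"
  using assms by (simp add: truss_rhd_def circ_mult circ_closed Phi_closed m_assoc)

text \<open>Apply the endomorphism \<open>a \<rhd> -\<close> to \<open>\<Phi>(b) \<cdot> (b \<rhd> c) = b \<circ> c\<close>. The first factor then
  contributes \<open>\<Phi>(a) \<cdot> (a \<rhd> \<Phi>(b)) = a \<circ> \<Phi>(b) = \<Phi>(a \<circ> b)\<close>, which can be cancelled.\<close>

lemma truss_rhd_circ:
  assumes a: "a \<in> carrier G" and b: "b \<in> carrier G" and c: "c \<in> carrier G"
  shows "truss_rhd G (a \<odot> b) c = truss_rhd G a (truss_rhd G b c)"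
proof -
  note closed = a b c circ_closed Phi_closed truss_rhd_closed
  have "\<Phi> (a \<odot> b) \<otimes> truss_rhd G a (truss_rhd G b c) =
      \<Phi> a \<otimes> (truss_rhd G a (\<Phi> b) \<otimes> truss_rhd G a (truss_rhd G b c))"
    using Phi_mult_truss_rhd[of a "\<Phi> b"] by (simp add: closed Phi_circ flip: m_assoc)
  also have "\<dots> = \<Phi> a \<otimes> truss_rhd G a (b \<odot> c)"
    by (simp add: closed Phi_mult_truss_rhd flip: truss_rhd_mult)
  also have "\<dots> = \<Phi> (a \<odot> b) \<otimes> truss_rhd G (a \<odot> b) c"
    by (simp add: closed Phi_mult_truss_rhd circ_assoc)
  finally show ?thesis
    by (simp add: closed)
qed

lemma post_circ_wtg_of_truss:
  "\<lbrakk>a \<in> carrier G; b \<in> carrier G\<rbrakk> \<Longrightarrow> a \<bullet>\<^bsub>wtg_of_truss G\<^esub> b = a \<odot> b"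
  by (simp add: post_circ_def Phi_mult_truss_rhd)

lemma weak_twisted_post_group_wtg_of_truss: "weak_twisted_post_group (wtg_of_truss G)"
proof (intro weak_twisted_post_group.intro weak_twisted_post_group_axioms.intro)
  show "group (wtg_of_truss G)"
    by (rule group_of_same_operations[OF is_group]) simp_all
qed (simp_all add: hom_def Pi_iff Phi_closed circ_closed truss_rhd_closed truss_rhd_mult
      truss_rhd_circ post_circ_wtg_of_truss Phi_circ)

end

section \<open>From weak twisted post-groups to skew trusses\<close>

definition truss_of_wtg :: "('a, 'b) weak_twisted_post_group_scheme \<Rightarrow> 'a skew_truss"
  where "truss_of_wtg G =
    \<lparr>carrier = carrier G, mult = mult G, one = one G, Phi = Phi G,
     circ = curry (restrict (case_prod (post_circ G)) (carrier G \<times> carrier G))\<rparr>"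

lemma truss_of_wtg_simps [simp]:
  "carrier (truss_of_wtg G) = carrier G" "mult (truss_of_wtg G) = mult G"
  "one (truss_of_wtg G) = one G" "Phi (truss_of_wtg G) = Phi G"
  "m_inv (truss_of_wtg G) = m_inv G"
  "\<lbrakk>a \<in> carrier G; b \<in> carrier G\<rbrakk> \<Longrightarrow> a \<odot>\<^bsub>truss_of_wtg G\<^esub> b = a \<bullet>\<^bsub>G\<^esub> b"
  by (simp_all add: truss_of_wtg_def m_inv_def fun_eq_iff)

context weak_twisted_post_group
begin

lemma rhd_closed: "\<lbrakk>a \<in> carrier G; b \<in> carrier G\<rbrakk> \<Longrightarrow> a \<rhd> b \<in> carrier G"
  using rhd_hom by (auto simp: hom_def)

lemma rhd_mult:
  "\<lbrakk>a \<in> carrier G; b \<in> carrier G; c \<in> carrier G\<rbrakk> \<Longrightarrow> a \<rhd> (b \<otimes> c) = (a \<rhd> b) \<otimes> (a \<rhd> c)"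
  using rhd_hom by (auto simp: hom_def)

lemma post_circ_closed: "\<lbrakk>a \<in> carrier G; b \<in> carrier G\<rbrakk> \<Longrightarrow> a \<bullet> b \<in> carrier G"
  by (simp add: post_circ_def rhd_closed Phi_closed)

text \<open>Both sides equal \<open>\<Phi>(a) \<cdot> (a \<rhd> \<Phi>(b)) \<cdot> (a \<rhd> (b \<rhd> c))\<close>: on the left the first two factors come
  from \<open>\<Phi>(a \<circ> b) = a \<circ> \<Phi>(b)\<close>, on the right the last two from the endomorphism \<open>a \<rhd> -\<close>.\<close>

lemma post_circ_assoc:
  assumes a: "a \<in> carrier G" and b: "b \<in> carrier G" and c: "c \<in> carrier G"
  shows "(a \<bullet> b) \<bullet> c = a \<bullet> (b \<bullet> c)"
proof -
  have "(a \<bullet> b) \<bullet> c = \<Phi> (a \<bullet> b) \<otimes> ((a \<bullet> b) \<rhd> c)"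
    by (rule post_circ_def)
  also have "\<dots> = (\<Phi> a \<otimes> (a \<rhd> \<Phi> b)) \<otimes> (a \<rhd> (b \<rhd> c))"
    using a b c by (simp add: Phi_post_circ post_circ_rhd post_circ_def[of G a "\<Phi> b"])
  also have "\<dots> = \<Phi> a \<otimes> (a \<rhd> (\<Phi> b \<otimes> (b \<rhd> c)))"
    using a b c by (simp add: m_assoc rhd_mult rhd_closed Phi_closed)
  also have "\<dots> = a \<bullet> (b \<bullet> c)"
    by (simp add: post_circ_def)
  finally show ?thesis .
qed

lemma post_circ_mult:
  assumes a: "a \<in> carrier G" and b: "b \<in> carrier G" and c: "c \<in> carrier G"
  shows "a \<bullet> (b \<otimes> c) = (a \<bullet> b) \<otimes> inv (\<Phi> a) \<otimes> (a \<bullet> c)"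
proof -
  have "inv (\<Phi> a) \<otimes> (\<Phi> a \<otimes> (a \<rhd> c)) = a \<rhd> c"
    using a c by (simp add: rhd_closed Phi_closed flip: m_assoc)
  then show ?thesis
    using a b c by (simp add: post_circ_def m_assoc rhd_mult rhd_closed Phi_closed)
qed

lemma skew_truss_truss_of_wtg: "skew_truss (truss_of_wtg G)"
proof (intro skew_truss.intro skew_truss_axioms.intro)
  show "group (truss_of_wtg G)"
    by (rule group_of_same_operations[OF is_group]) simp_all
qed (simp_all add: Phi_closed post_circ_closed post_circ_assoc post_circ_mult)

lemma truss_rhd_truss_of_wtg:
  "\<lbrakk>a \<in> carrier G; b \<in> carrier G\<rbrakk> \<Longrightarrow> truss_rhd (truss_of_wtg G) a b = a \<rhd> b"
  by (simp add: truss_rhd_def post_circ_def rhd_closed Phi_closed flip: m_assoc)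

end

section \<open>The two categories\<close>

text \<open>The constructions change only the second operation, and outside the carrier both the given
  and the reconstructed operation are undefined, so agreement on the carrier makes the records
  equal.\<close>

lemma curry_restrict_eq:
  assumes "case_prod f \<in> extensional (A \<times> B)"
    and "\<And>a b. \<lbrakk>a \<in> A; b \<in> B\<rbrakk> \<Longrightarrow> g a b = f a b"
  shows "curry (restrict (case_prod g) (A \<times> B)) = f"
proof -
  have "restrict (case_prod g) (A \<times> B) = case_prod f"
    by (rule extensionalityI[OF restrict_extensional assms(1)]) (auto simp: assms(2))
  then show ?thesis
    by simp
qed

lemma truss_of_wtg_of_truss:
  assumes "X \<in> Obj ST"
  shows "truss_of_wtg (wtg_of_truss X) = X"
proof -
  interpret skew_truss X using assms by (simp add: ST_def)
  have "curry (restrict (case_prod (post_circ (wtg_of_truss X))) (carrier X \<times> carrier X)) = circ X"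
    using assms by (intro curry_restrict_eq) (simp_all add: ST_def post_circ_wtg_of_truss)
  then show ?thesis
    by (simp add: truss_of_wtg_def)
qed

lemma wtg_of_truss_of_wtg:
  assumes "Y \<in> Obj WTG"
  shows "wtg_of_truss (truss_of_wtg Y) = Y"
proof -
  interpret weak_twisted_post_group Y using assms by (simp add: WTG_def)
  have "curry (restrict (case_prod (truss_rhd (truss_of_wtg Y))) (carrier Y \<times> carrier Y)) = rhd Y"
    using assms by (intro curry_restrict_eq) (simp_all add: WTG_def truss_rhd_truss_of_wtg)
  then show ?thesis
    by (simp add: wtg_of_truss_def)
qed

lemma wtg_of_truss_in_WTG:
  assumes "X \<in> Obj ST"
  shows "wtg_of_truss X \<in> Obj WTG"
  using assms skew_truss.weak_twisted_post_group_wtg_of_truss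
  by (auto simp: ST_def WTG_def wtg_of_truss_def)

lemma truss_of_wtg_in_ST:
  assumes "Y \<in> Obj WTG"
  shows "truss_of_wtg Y \<in> Obj ST"
  using assms weak_twisted_post_group.skew_truss_truss_of_wtg
  by (auto simp: ST_def WTG_def truss_of_wtg_def)

text \<open>A group homomorphism that preserves \<open>\<circ>\<close> preserves \<open>\<Phi>(a) = a \<circ> 1\<close> and therefore
  \<open>a \<rhd> b = \<Phi>(a)\<^sup>-\<^sup>1 \<cdot> (a \<circ> b)\<close>; conversely \<open>a \<circ> b = \<Phi>(a) \<cdot> (a \<rhd> b)\<close>.\<close>

lemma hom_wtg_of_truss:
  assumes G: "skew_truss G" and H: "skew_truss H"
  shows "weak_twisted_post_group_hom (wtg_of_truss G) (wtg_of_truss H) = skew_truss_hom G H"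
proof -
  interpret G: skew_truss G by fact
  interpret H: skew_truss H by fact
  have hom_eq: "hom (wtg_of_truss G) (wtg_of_truss H) = hom G H"
    by (simp add: hom_def)
  have iff: "((\<forall>a \<in> carrier G. \<forall>b \<in> carrier G. F (truss_rhd G a b) = truss_rhd H (F a) (F b)) \<and>
      (\<forall>a \<in> carrier G. F (\<Phi>\<^bsub>G\<^esub> a) = \<Phi>\<^bsub>H\<^esub> (F a))) \<longleftrightarrow>
      (\<forall>a \<in> carrier G. \<forall>b \<in> carrier G. F (a \<odot>\<^bsub>G\<^esub> b) = F a \<odot>\<^bsub>H\<^esub> F b)"
    (is "?rhd \<and> ?Phi \<longleftrightarrow> ?circ")
    if F: "F \<in> hom G H" for F
  proof -
    interpret F: group_hom G H F
      using F by (simp add: group_hom_def group_hom_axioms_def G.is_group H.is_group)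
    have "F (a \<odot>\<^bsub>G\<^esub> b) = F a \<odot>\<^bsub>H\<^esub> F b"
      if "?rhd" "?Phi" and ab: "a \<in> carrier G" "b \<in> carrier G" for a b
    proof -
      have "F (a \<odot>\<^bsub>G\<^esub> b) = F (\<Phi>\<^bsub>G\<^esub> a \<otimes>\<^bsub>G\<^esub> truss_rhd G a b)"
        using ab by (simp add: G.Phi_mult_truss_rhd)
      also have "\<dots> = \<Phi>\<^bsub>H\<^esub> (F a) \<otimes>\<^bsub>H\<^esub> truss_rhd H (F a) (F b)"
        using that by (simp add: G.Phi_closed G.truss_rhd_closed)
      also have "\<dots> = F a \<odot>\<^bsub>H\<^esub> F b"
        using ab by (simp add: H.Phi_mult_truss_rhd)
      finally show ?thesis .
    qed
    moreover have Phi: "F (\<Phi>\<^bsub>G\<^esub> a) = \<Phi>\<^bsub>H\<^esub> (F a)" if "?circ" "a \<in> carrier G" for a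
      using that by (simp flip: G.circ_one H.circ_one)
    moreover have "F (truss_rhd G a b) = truss_rhd H (F a) (F b)"
      if "?circ" "a \<in> carrier G" "b \<in> carrier G" for a b
      using that Phi by (simp add: truss_rhd_def G.Phi_closed G.circ_closed)
    ultimately show ?thesis
      by blast
  qed
  have closed: "F a \<in> carrier H" if "F \<in> hom G H" "a \<in> carrier G" for F a
    using that by (auto simp: hom_def)
  show ?thesis
    unfolding weak_twisted_post_group_hom_def skew_truss_hom_def hom_eq wtg_of_truss_simps
  proof (intro Collect_cong conj_cong refl)
    fix F assume "F \<in> hom G H \<inter> extensional (carrier G)"
    then have F: "F \<in> hom G H"
      by blast
    show "((\<forall>a \<in> carrier G. \<forall>b \<in> carrier G.
          F (a \<rhd>\<^bsub>wtg_of_truss G\<^esub> b) = F a \<rhd>\<^bsub>wtg_of_truss H\<^esub> F b) \<and>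
        (\<forall>a \<in> carrier G. F (\<Phi>\<^bsub>G\<^esub> a) = \<Phi>\<^bsub>H\<^esub> (F a))) \<longleftrightarrow>
        (\<forall>a \<in> carrier G. \<forall>b \<in> carrier G. F (a \<odot>\<^bsub>G\<^esub> b) = F a \<odot>\<^bsub>H\<^esub> F b)"
      using iff[OF F] by (simp add: closed[OF F])
  qed
qed

lemma identity_in_hom: "group G \<Longrightarrow> (\<lambda>x \<in> carrier G. x) \<in> hom G G"
  by (simp add: hom_def Pi_iff monoid.m_closed group.is_monoid)

lemma category_ST: "category ST"
proof (rule category_of_extensional_functions)
  fix X :: "'a skew_truss" assume "X \<in> Obj ST"
  then interpret skew_truss X by (simp add: ST_def)
  show "(\<lambda>x \<in> carrier X. x) \<in> Hom ST X X"
    by (simp add: ST_def skew_truss_hom_def identity_in_hom circ_closed)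
next
  fix X Y Z :: "'a skew_truss" and f g
  assume "X \<in> Obj ST" "f \<in> Hom ST X Y" "g \<in> Hom ST Y Z"
  then interpret skew_truss X by (simp add: ST_def)
  show "compose (carrier X) g f \<in> Hom ST X Z"
    using \<open>f \<in> _\<close> \<open>g \<in> _\<close>
    by (auto simp: ST_def skew_truss_hom_def hom_def compose_def Pi_iff circ_closed)
qed (auto simp: ST_def skew_truss_hom_def hom_def)

lemma category_WTG: "category WTG"
proof (rule category_of_extensional_functions)
  fix X :: "'a weak_twisted_post_group" assume "X \<in> Obj WTG"
  then interpret weak_twisted_post_group X by (simp add: WTG_def)
  show "(\<lambda>x \<in> carrier X. x) \<in> Hom WTG X X"
    by (simp add: WTG_def weak_twisted_post_group_hom_def identity_in_hom rhd_closed Phi_closed)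
next
  fix X Y Z :: "'a weak_twisted_post_group" and f g
  assume "X \<in> Obj WTG" "f \<in> Hom WTG X Y" "g \<in> Hom WTG Y Z"
  then interpret weak_twisted_post_group X by (simp add: WTG_def)
  show "compose (carrier X) g f \<in> Hom WTG X Z"
    using \<open>f \<in> _\<close> \<open>g \<in> _\<close>
    by (auto simp: WTG_def weak_twisted_post_group_hom_def hom_def compose_def Pi_iff
        rhd_closed Phi_closed)
qed (auto simp: WTG_def weak_twisted_post_group_hom_def hom_def)

theorem theorem4p5:
  shows "isomorphic_categories
    (ST :: ('a skew_truss, 'a \<Rightarrow> 'a) category)
    (WTG :: ('a weak_twisted_post_group, 'a \<Rightarrow> 'a) category)"
proof (rule isomorphic_categories_by_objects[where P = wtg_of_truss and Q = truss_of_wtg])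
  fix X Y :: "'a skew_truss"
  assume "X \<in> Obj ST" "Y \<in> Obj ST"
  then show "Hom WTG (wtg_of_truss X) (wtg_of_truss Y) = Hom ST X Y"
    by (simp add: ST_def WTG_def hom_wtg_of_truss)
qed (simp_all add: category_ST category_WTG wtg_of_truss_in_WTG truss_of_wtg_in_ST
      truss_of_wtg_of_truss wtg_of_truss_of_wtg, simp_all add: ST_def WTG_def)

end
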